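(* Let $X=\{X(t),t\in T\}$ be a random process from the space $D_{V,W}(\Omega)$ with $\|\cdot\|=\|\cdot\|_{V,W}$, let $\rho_X(t,s)=\|X(t)-X(s)\|$, and suppose: (A1) $\sup_{t\in T}\|X(t)\|<\infty$; (A2) the space $(T,\rho_X)$ is separable and the process $X$ is separable on $(T,\rho_X)$. Let $\varepsilon_0=\sup_{t,s\in T}\rho_X(t,s)$, $\theta\in(0,1)$, $\varepsilon_k=\varepsilon_0\theta^k$, let $N(\varepsilon)$ be the minimal number of closed balls of radius $\varepsilon$ that cover $(T,\rho_X)$, let $\kappa(n)$ be a majorizing characteristic of $D_{V,W}(\Omega)$, and let $f(x)=xV(W(x))$. If the series $$\sum_{n=1}^\infty V^{(-1)}\left(\frac{\kappa(N(\varepsilon_n))^2\varepsilon_{n-1}^2}{f^{(-1)}\big(\kappa(N(\varepsilon_n))^2\varepsilon_{n-1}^2\big)}\right)$$ converges, then for $x>\Psi$ $$P\Big\{\sup_{t\in T}|X(t)|\ge x\Big\}\le W\left(\frac{\inf_{t\in T}\|X(t)\|^2}{V(\psi_0x)}\right)+\sum_{k=1}^\infty W\left(\frac{\kappa(N(\varepsilon_k))^2\varepsilon_{k-1}^2}{V(\psi_kx)}\right),$$ where $$\Psi=V^{(-1)}\left(\frac{\inf_{t\in T}\|X(t)\|^2}{f^{(-1)}(\inf_{t\in T}\|X(t)\|^2)}\right)+\sum_{k=1}^\infty V^{(-1)}\left(\frac{\kappa(N(\varepsilon_k))^2\varepsilon_{k-1}^2}{f^{(-1)}(\kappa(N(\varepsilon_k))^2\varepsilon_{k-1}^2)}\right),$$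 $$\psi_0=\frac1\Psi V^{(-1)}\left(\frac{\inf_{t\in T}\|X(t)\|^2}{f^{(-1)}(\inf_{t\in T}\|X(t)\|^2)}\right),\qquad\psi_k=\frac1\Psi V^{(-1)}\left(\frac{\kappa(N(\varepsilon_k))^2\varepsilon_{k-1}^2}{f^{(-1)}(\kappa(N(\varepsilon_k))^2\varepsilon_{k-1}^2)}\right).$$
   Context: $W=\{W(x),x\in\mathbb R\}$ and $V=\{V(x),x\in\mathbb R\}$ are even functions, continuous and monotonically increasing for $x>0$, positive for $x\ne0$, such that: (1) there is $C>0$ with $W^{(-1)}(x+y)\le C(W^{(-1)}(x)+W^{(-1)}(y))$ for all $x,y>0$, where $W^{(-1)}$ is the inverse of $W$ on $x>0$; (2) there is a continuous function $Z=\{Z(x),x>0\}$, $0<Z(x)<\infty$, with $V(ax)\le Z(a)V(x)$ for all $a>0$, $x>0$; (3) $W(0)=0$. $V^{(-1)}$ and $f^{(-1)}$ are inverses for $x>0$. $D_{V,W}(\Omega)$ is the space of random variables $\xi$ with $\sup_{x\ge0}V(x)W^{(-1)}(P\{|\xi|>x\})<\infty$, with prenorm $\|\xi\|_{V,W}=\big(\sup_{x>0}V(x)W^{(-1)}(P\{|\xi|>x\})\big)^{1/2}$. A process belongs to the space if each $X(t)$ does. $\rho_X$ is a premetric (nonnegative, symmetric, $\rho_X(t,t)=0$). A majorizing characteristic is a non-decreasing sequence $\kappa(n)$ with $\|\max_{1\le i\le n}|\xi_i|\|\le\kappa(n)\max_{1\le i\le n}\|\xi_i\|$ for all $\xi_1,\dots,\xi_n\in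 D_{V,W}(\Omega)$. Since $X$ is continuous in probability with respect to $\rho_X$, separability is used in the form: for any countable set $S$ everywhere dense in $(T,\rho_X)$, $\sup_{t\in T}|X(t)|=\sup_{t\in S}|X(t)|$ almost surely. *)

theory Defs
  imports "HOL-Probability.Probability"
begin

text \<open>
  The inverse of the restriction of \<open>g\<close> to the positive half-line, extended by \<open>0\<close> to arguments
  that \<open>g\<close> does not take there. The extension is needed at the argument \<open>0\<close>: it gives
  \<open>W\<^sup>-\<^sup>1 0 = 0\<close> for the tail probability \<open>0\<close>, and it reads the degenerate expression
  \<open>V\<^sup>-\<^sup>1 (a / f\<^sup>-\<^sup>1 a)\<close> at \<open>a = 0\<close> as \<open>0\<close>, which is its limit for \<open>a\<close> tending to \<open>0\<close> from above.
\<close>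

definition inv_pos :: "(real \<Rightarrow> real) \<Rightarrow> real \<Rightarrow> real" where
  "inv_pos g y = (if y \<in> g ` {0<..} then the_inv_into {0<..} g y else 0)"

text \<open>
  The inverses require strict monotonicity. Condition (1) speaks of \<open>W\<^sup>-\<^sup>1\<close> at every positive
  argument; this is the surjectivity clause. The range of \<open>V\<close> is not restricted, since
  \<open>V\<^sup>-\<^sup>1\<close> is only used at values \<open>a / f\<^sup>-\<^sup>1 a = V (W (f\<^sup>-\<^sup>1 a))\<close>.
\<close>

definition admissible_pair :: "(real \<Rightarrow> real) \<Rightarrow> (real \<Rightarrow> real) \<Rightarrow> bool" where
  "admissible_pair V W \<longleftrightarrow>
     (\<forall>x. V (- x) = V x) \<and> (\<forall>x. W (- x) = W x) \<and>
     continuous_on {0<..} V \<and> continuous_on {0<..} W \<and>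
     strict_mono_on {0<..} V \<and> strict_mono_on {0<..} W \<and>
     (\<forall>x. x \<noteq> 0 \<longrightarrow> 0 < V x) \<and> (\<forall>x. x \<noteq> 0 \<longrightarrow> 0 < W x) \<and>
     W ` {0<..} = {0<..} \<and>
     (\<exists>C>0. \<forall>x>0. \<forall>y>0. inv_pos W (x + y) \<le> C * (inv_pos W x + inv_pos W y)) \<and>
     (\<exists>Z. continuous_on {0<..} Z \<and> (\<forall>a>0. 0 < Z a) \<and>
          (\<forall>a>0. \<forall>x>0. V (a * x) \<le> Z a * V x)) \<and>
     W 0 = 0"

definition tail_weight ::
  "'w measure \<Rightarrow> (real \<Rightarrow> real) \<Rightarrow> (real \<Rightarrow> real) \<Rightarrow> ('w \<Rightarrow> real) \<Rightarrow> real \<Rightarrow> real" where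
  "tail_weight M V W \<xi> x = V x * inv_pos W (measure M {\<omega> \<in> space M. \<bar>\<xi> \<omega>\<bar> > x})"

definition D_VW :: "'w measure \<Rightarrow> (real \<Rightarrow> real) \<Rightarrow> (real \<Rightarrow> real) \<Rightarrow> ('w \<Rightarrow> real) set" where
  "D_VW M V W = {\<xi> \<in> borel_measurable M. bdd_above (tail_weight M V W \<xi> ` {0..})}"

definition norm_VW ::
  "'w measure \<Rightarrow> (real \<Rightarrow> real) \<Rightarrow> (real \<Rightarrow> real) \<Rightarrow> ('w \<Rightarrow> real) \<Rightarrow> real" where
  "norm_VW M V W \<xi> = sqrt (SUP x\<in>{0<..}. tail_weight M V W \<xi> x)"

definition majorizing_characteristic ::
  "'w measure \<Rightarrow> (real \<Rightarrow> real) \<Rightarrow> (real \<Rightarrow> real) \<Rightarrow> (nat \<Rightarrow> real) \<Rightarrow> bool" where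
  "majorizing_characteristic M V W \<kappa> \<longleftrightarrow>
     mono_on {1..} \<kappa> \<and>
     (\<forall>n\<ge>1. \<forall>\<xi> :: nat \<Rightarrow> 'w \<Rightarrow> real. (\<forall>i\<in>{1..n}. \<xi> i \<in> D_VW M V W) \<longrightarrow>
        norm_VW M V W (\<lambda>\<omega>. MAX i\<in>{1..n}. \<bar>\<xi> i \<omega>\<bar>)
          \<le> \<kappa> n * (MAX i\<in>{1..n}. norm_VW M V W (\<xi> i)))"

text \<open>
  A premetric need not satisfy the triangle inequality, so the metric-space notions of the
  library do not apply; density and covering are stated through balls.
\<close>

definition dense_in :: "'t set \<Rightarrow> ('t \<Rightarrow> 't \<Rightarrow> real) \<Rightarrow> 't set \<Rightarrow> bool" where
  "dense_in T \<rho> S \<longleftrightarrow> S \<subseteq> T \<and> (\<forall>t\<in>T. \<forall>e>0. \<exists>s\<in>S. \<rho> t s < e)"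

definition premetric_separable :: "'t set \<Rightarrow> ('t \<Rightarrow> 't \<Rightarrow> real) \<Rightarrow> bool" where
  "premetric_separable T \<rho> \<longleftrightarrow> (\<exists>S. countable S \<and> dense_in T \<rho> S)"

definition separable_process ::
  "'w measure \<Rightarrow> 't set \<Rightarrow> ('t \<Rightarrow> 't \<Rightarrow> real) \<Rightarrow> ('t \<Rightarrow> 'w \<Rightarrow> real) \<Rightarrow> bool" where
  "separable_process M T \<rho> X \<longleftrightarrow>
     (\<forall>S. countable S \<and> dense_in T \<rho> S \<longrightarrow>
        (AE \<omega> in M. (SUP t\<in>T. ereal \<bar>X t \<omega>\<bar>) = (SUP t\<in>S. ereal \<bar>X t \<omega>\<bar>)))"

definition closed_ball_cover :: "'t set \<Rightarrow> ('t \<Rightarrow> 't \<Rightarrow> real) \<Rightarrow> real \<Rightarrow> 't set \<Rightarrow> bool" where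
  "closed_ball_cover T \<rho> r F \<longleftrightarrow> finite F \<and> F \<subseteq> T \<and> T \<subseteq> (\<Union>c\<in>F. {t \<in> T. \<rho> c t \<le> r})"

text \<open>Meaningful only if some finite cover exists.\<close>

definition covering_number :: "'t set \<Rightarrow> ('t \<Rightarrow> 't \<Rightarrow> real) \<Rightarrow> real \<Rightarrow> nat" where
  "covering_number T \<rho> r = (LEAST n. \<exists>F. closed_ball_cover T \<rho> r F \<and> card F = n)"

text \<open>
  The supremum over an uncountable \<open>T\<close> agrees with a measurable function only almost surely, so
  the event is measurable with respect to the completion of the measure, but possibly not with
  respect to the measure itself. Its probability is therefore taken in the completion.
\<close>

lemma sup_event_measurable:
  assumes "premetric_separable T \<rho>" "separable_process M T \<rho> X"
    and "\<And>t. t \<in> T \<Longrightarrow> X t \<in> borel_measurable M"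
  shows "{\<omega> \<in> space M. (SUP t\<in>T. ereal \<bar>X t \<omega>\<bar>) \<ge> ereal x} \<in> sets (completion M)"
proof -
  obtain S where S: "countable S" "dense_in T \<rho> S"
    using assms(1) by (auto simp: premetric_separable_def)
  have "S \<subseteq> T"
    using S(2) by (auto simp: dense_in_def)
  have "(\<lambda>\<omega>. SUP t\<in>S. ereal \<bar>X t \<omega>\<bar>) \<in> borel_measurable M"
    using assms(3) S(1) \<open>S \<subseteq> T\<close> by (intro borel_measurable_SUP) auto
  then have m: "{\<omega> \<in> space M. (SUP t\<in>S. ereal \<bar>X t \<omega>\<bar>) \<ge> ereal x} \<in> sets M"
    by measurable
  have "AE \<omega> in M. (SUP t\<in>T. ereal \<bar>X t \<omega>\<bar>) = (SUP t\<in>S. ereal \<bar>X t \<omega>\<bar>)"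
    using assms(2) S by (auto simp: separable_process_def)
  then obtain N where
    "\<And>\<omega>. \<omega> \<in> space M - N \<Longrightarrow> (SUP t\<in>T. ereal \<bar>X t \<omega>\<bar>) = (SUP t\<in>S. ereal \<bar>X t \<omega>\<bar>)"
    "N \<in> null_sets M"
    by (rule AE_E3) blast
  then have N: "N \<in> null_sets M"
    "{\<omega> \<in> space M. (SUP t\<in>T. ereal \<bar>X t \<omega>\<bar>) \<noteq> (SUP t\<in>S. ereal \<bar>X t \<omega>\<bar>)} \<subseteq> N"
    by auto
  let ?A = "{\<omega> \<in> space M. (SUP t\<in>T. ereal \<bar>X t \<omega>\<bar>) \<ge> ereal x}"
  let ?B = "{\<omega> \<in> space M. (SUP t\<in>S. ereal \<bar>X t \<omega>\<bar>) \<ge> ereal x}"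
  have eq: "?A = (?B - N) \<union> (?A \<inter> N)"
    using N(2) by auto
  show ?thesis
    by (rule sets_completionI[OF eq _ N(1)]) (use m N(1) in auto)
qed

end

theory Submission imports Defs begin

text \<open>
  The proof is a chaining argument in which the triangle inequality is replaced by tail estimates.
  The norm is designed so that \<open>P(|\<xi>| > u) \<le> W (\<parallel>\<xi>\<parallel>\<^sup>2 / V u)\<close> (\<open>tail_bound\<close>), and a majorizing
  characteristic extends this estimate from one variable to the maximum over a finite net
  (\<open>finite_sup_tail_bound\<close>). Take a minimal cover at each radius \<open>\<epsilon> k\<close>, \<open>k \<ge> 1\<close>, and descend from a
  point of a cover to the ball centres of the coarser covers, ending in one fixed point \<open>t0\<close>. The
  union of the centres is countable and dense, so by separability the supremum over \<open>T\<close> is almost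
  surely the supremum over the centres. If \<open>|X t0|\<close> and the increments of level \<open>k\<close> stay below
  thresholds \<open>u k\<close> with \<open>\<Sum>k. u k < x\<close>, then so does the process stay below \<open>x\<close>
  (\<open>chain_union_bound\<close>). The increments of level \<open>k\<close> fail to do so with probability at most
  \<open>W (a k / V (u k))\<close>.

  The thresholds \<open>u k = \<psi> k * x\<close> are proportional to the levels \<open>v k = V\<^sup>-\<^sup>1 (a k / f\<^sup>-\<^sup>1 (a k))\<close>. The
  choice of \<open>f\<close> makes \<open>v k\<close> the solution of \<open>W (a k / V u) = u\<close>, and \<open>x > \<Psi>\<close> gives \<open>u k \<ge> v k\<close>;
  hence \<open>W (a k / V (u k)) \<le> v k\<close> (\<open>tail_bound_le_level\<close>) and the series on the right converges along
  with the series of levels.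

  Three passages to the limit remain. The chaining bound needs a little room below \<open>x\<close>, because the
  event is closed and because the threshold of the starting point has to be positive even if \<open>\<psi> 0 = 0\<close>.
  It is therefore applied with \<open>y * \<psi> k\<close>, \<open>\<Psi> < y < x\<close>, and with some \<open>d > 0\<close> added for \<open>k = 0\<close>. The
  norm of \<open>X t0\<close> is replaced by the infimum because \<open>W\<close> is continuous up to \<open>0\<close>, the summand \<open>d\<close> is
  dropped by monotonicity, and \<open>y\<close> tends to \<open>x\<close> under the series by domination by the levels.
\<close>

section \<open>The two generating functions and their inverses\<close>

locale VW_pair =
  fixes V W :: "real \<Rightarrow> real"
  assumes admissible: "admissible_pair V W"
begin

lemma V_pos: "0 < x \<Longrightarrow> 0 < V x"
  using admissible unfolding admissible_pair_def by force

lemma V_mono: "0 < x \<Longrightarrow> x \<le> y \<Longrightarrow> V x \<le> V y"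
  using admissible unfolding admissible_pair_def
  by (intro strict_mono_on_leD[of "{0<..}" V]) auto

lemma V_inj: "inj_on V {0<..}"
  using admissible unfolding admissible_pair_def by (intro strict_mono_on_imp_inj_on) auto

lemma V_isCont: "0 < x \<Longrightarrow> isCont V x"
  using admissible unfolding admissible_pair_def
  by (auto simp: continuous_on_eq_continuous_at)

lemma W_0: "W 0 = 0"
  using admissible unfolding admissible_pair_def by (elim conjE)

lemma W_pos: "0 < x \<Longrightarrow> 0 < W x"
  using admissible unfolding admissible_pair_def by force

lemma W_nonneg: "0 \<le> x \<Longrightarrow> 0 \<le> W x"
  using W_pos[of x] W_0 by (cases "x = 0") auto

lemma W_mono: "0 \<le> x \<Longrightarrow> x \<le> y \<Longrightarrow> W x \<le> W y"
proof (cases "x = 0")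
  case False
  assume "0 \<le> x" "x \<le> y"
  then show ?thesis
    using False admissible unfolding admissible_pair_def
    by (intro strict_mono_on_leD[of "{0<..}" W]) auto
qed (auto simp: W_0 W_nonneg)

lemma W_strict_mono: "0 < x \<Longrightarrow> x < y \<Longrightarrow> W x < W y"
  using admissible unfolding admissible_pair_def
  by (intro strict_mono_onD[of "{0<..}" W]) auto

lemma W_inj: "inj_on W {0<..}"
  using admissible unfolding admissible_pair_def by (intro strict_mono_on_imp_inj_on) auto

lemma W_surj:
  assumes "0 < p"
  shows "\<exists>y>0. W y = p"
proof -
  have "W ` {0<..} = {0<..}"
    using admissible unfolding admissible_pair_def by (elim conjE)
  then have "p \<in> W ` {0<..}"
    using assms by simp
  then show ?thesis
    by auto
qed

lemma W_isCont: "0 < x \<Longrightarrow> isCont W x"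
  using admissible unfolding admissible_pair_def
  by (auto simp: continuous_on_eq_continuous_at)

text \<open>
  Continuity from the right at \<open>0\<close> comes from the fact that \<open>W\<close> takes arbitrarily small positive
  values; it is what allows a passage to the limit in the starting point of a chain even when the
  infimum of the norms is \<open>0\<close>.
\<close>

lemma W_continuous_on: "continuous_on {0..} W"
proof (unfold continuous_on_iff, intro ballI allI impI)
  fix x e :: real
  assume x: "x \<in> {0..}" and e: "0 < e"
  show "\<exists>d>0. \<forall>x'\<in>{0..}. dist x' x < d \<longrightarrow> dist (W x') (W x) < e"
  proof (cases "x = 0")
    case True
    obtain d where d: "d > 0" "W d = e"
      using W_surj[OF e] by blast
    have "dist (W y) (W x) < e" if "y \<in> {0..}" "dist y x < d" for y
    proof (cases "y = 0")
      case False
      then have "W y < W d"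
        using that True by (intro W_strict_mono) (auto simp: dist_real_def)
      moreover have "0 \<le> W y"
        using that by (intro W_nonneg) auto
      ultimately show ?thesis
        using d True by (simp add: W_0)
    qed (use e True in auto)
    then show ?thesis
      using d by blast
  next
    case False
    then have "isCont W x"
      using x by (intro W_isCont) auto
    then obtain d where "d > 0" "\<forall>x'. dist x' x < d \<longrightarrow> dist (W x') (W x) < e"
      using e unfolding continuous_at_eps_delta by metis
    then show ?thesis
      by (intro exI[of _ d]) simp
  qed
qed

lemma inv_W_W: "0 < y \<Longrightarrow> inv_pos W (W y) = y"
  unfolding inv_pos_def by (auto intro!: the_inv_into_f_f W_inj)

lemma inv_W_0: "inv_pos W 0 = 0"
proof -
  have "(0::real) \<notin> W ` {0<..}"
    using W_pos by force
  then show ?thesis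
    by (simp add: inv_pos_def)
qed

lemma inv_W_pos:
  assumes "0 < p"
  shows "0 < inv_pos W p"
proof -
  obtain y where "0 < y" "W y = p"
    using W_surj[OF assms] by blast
  then show ?thesis
    using inv_W_W[of y] by simp
qed

lemma inv_W_nonneg: "0 \<le> p \<Longrightarrow> 0 \<le> inv_pos W p"
  using inv_W_pos[of p] inv_W_0 by (cases "p = 0") auto

lemma W_inv_W:
  assumes "0 \<le> p"
  shows "W (inv_pos W p) = p"
proof (cases "p = 0")
  case False
  then obtain y where "0 < y" "W y = p"
    using W_surj[of p] assms by auto
  then show ?thesis
    using inv_W_W[of y] by simp
qed (simp add: inv_W_0 W_0)

lemma inv_W_mono:
  assumes "0 \<le> p" "p \<le> q"
  shows "inv_pos W p \<le> inv_pos W q"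
proof (rule ccontr)
  assume less: "\<not> inv_pos W p \<le> inv_pos W q"
  show False
  proof (cases "q = 0")
    case False
    then have "W (inv_pos W q) < W (inv_pos W p)"
      using less assms by (intro W_strict_mono inv_W_pos) auto
    moreover have "W (inv_pos W q) = q" "W (inv_pos W p) = p"
      using assms by (auto intro!: W_inv_W)
    ultimately show False
      using assms by linarith
  qed (use less assms in auto)
qed

lemma inv_W_quasi_subadditive:
  obtains C where "C > 0"
    "\<And>p q. 0 \<le> p \<Longrightarrow> 0 \<le> q \<Longrightarrow> inv_pos W (p + q) \<le> C * (inv_pos W p + inv_pos W q)"
proof -
  have "\<exists>C>0. \<forall>p>0. \<forall>q>0. inv_pos W (p + q) \<le> C * (inv_pos W p + inv_pos W q)"
    using admissible unfolding admissible_pair_def by (elim conjE)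
  then obtain C where C: "C > 0"
    "\<And>p q. 0 < p \<Longrightarrow> 0 < q \<Longrightarrow> inv_pos W (p + q) \<le> C * (inv_pos W p + inv_pos W q)"
    by blast
  have "inv_pos W (p + q) \<le> max C 1 * (inv_pos W p + inv_pos W q)"
    if pq: "0 \<le> p" "0 \<le> q" for p q
  proof -
    have nn: "0 \<le> inv_pos W p + inv_pos W q"
      using pq inv_W_nonneg by auto
    show ?thesis
    proof (cases "p = 0 \<or> q = 0")
      case True
      then have "inv_pos W (p + q) = 1 * (inv_pos W p + inv_pos W q)"
        by (auto simp: inv_W_0)
      also have "\<dots> \<le> max C 1 * (inv_pos W p + inv_pos W q)"
        by (intro mult_right_mono nn) auto
      finally show ?thesis .
    next
      case False
      then have "inv_pos W (p + q) \<le> C * (inv_pos W p + inv_pos W q)"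
        using pq by (intro C) auto
      also have "\<dots> \<le> max C 1 * (inv_pos W p + inv_pos W q)"
        by (intro mult_right_mono nn) auto
      finally show ?thesis .
    qed
  qed
  then show ?thesis
    using that[of "max C 1"] by auto
qed

text \<open>
  The function \<open>y * V (W y)\<close> maps the positive half-line onto itself: the linear function
  \<open>y * V (W 1)\<close> lies above it for \<open>y \<le> 1\<close> and below it for \<open>y \<ge> 1\<close>, so it takes values on both
  sides of every positive number.
\<close>

lemma f_surj:
  assumes "0 < a"
  shows "\<exists>y>0. y * V (W y) = a"
proof -
  define c where "c = V (W 1)"
  have c: "c > 0"
    unfolding c_def by (intro V_pos W_pos) auto
  define l u where "l = min 1 (a / c)" and "u = max 1 (a / c)"
  have l: "0 < l" "l \<le> 1" "l \<le> a / c"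
    using assms c by (auto simp: l_def)
  have u: "1 \<le> u" "a / c \<le> u"
    by (auto simp: u_def)
  have "l * V (W l) \<le> l * c"
    unfolding c_def using l by (intro mult_left_mono V_mono W_pos W_mono) auto
  also have "\<dots> \<le> a"
    using l c by (simp add: field_simps)
  finally have lo: "l * V (W l) \<le> a" .
  have "a \<le> u * c"
    using u c by (simp add: field_simps)
  also have "\<dots> \<le> u * V (W u)"
    unfolding c_def using u by (intro mult_left_mono V_mono W_pos W_mono) auto
  finally have hi: "a \<le> u * V (W u)" .
  have "continuous_on {l..u} (\<lambda>y. y * V (W y))"
  proof (intro continuous_at_imp_continuous_on ballI)
    fix y assume "y \<in> {l..u}"
    then have "0 < y"
      using l by auto
    then have "isCont (\<lambda>y. V (W y)) y"
      using isCont_o2[OF W_isCont V_isCont] W_pos by blast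
    then show "isCont (\<lambda>y. y * V (W y)) y"
      by (intro continuous_intros) auto
  qed
  then obtain y where "l \<le> y" "y * V (W y) = a"
    using IVT'[of "\<lambda>y. y * V (W y)" l a u, OF lo hi] l u by auto
  then show ?thesis
    using l by (intro exI[of _ y]) auto
qed

lemma f_strict_mono: "strict_mono_on {0<..} (\<lambda>y. y * V (W y))"
proof (rule strict_mono_onI)
  fix y z :: real
  assume yz: "y \<in> {0<..}" "z \<in> {0<..}" "y < z"
  then have "y * V (W y) < z * V (W y)"
    using V_pos W_pos by auto
  also have "\<dots> \<le> z * V (W z)"
    using yz by (intro mult_left_mono V_mono W_pos W_mono) auto
  finally show "y * V (W y) < z * V (W z)" .
qed

text \<open>
  The level \<open>V\<^sup>-\<^sup>1 (a / f\<^sup>-\<^sup>1 a)\<close> is the fixed point \<open>u\<close> of the tail bound \<open>u \<mapsto> W (a / V u)\<close>: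
  with \<open>y = f\<^sup>-\<^sup>1 a\<close> one has \<open>a / y = V (W y)\<close>, so the level is \<open>W y\<close>.
\<close>

definition level :: "real \<Rightarrow> real" where
  "level a = inv_pos V (a / inv_pos (\<lambda>y. y * V (W y)) a)"

lemma level_0: "level 0 = 0"
proof -
  have "(0::real) \<notin> V ` {0<..}"
    using V_pos by force
  then show ?thesis
    by (simp add: level_def inv_pos_def)
qed

lemma level_eq:
  assumes "0 < a"
  obtains y where "0 < y" "level a = W y" "a = y * V (W y)"
proof -
  obtain y where y: "y > 0" "y * V (W y) = a"
    using f_surj[OF assms] by blast
  have "inv_pos (\<lambda>y. y * V (W y)) a = y"
    unfolding inv_pos_def using y
    by (auto intro!: the_inv_into_f_eq strict_mono_on_imp_inj_on[OF f_strict_mono])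
  then have "level a = inv_pos V (V (W y))"
    using y(1) unfolding level_def y(2)[symmetric] by simp
  also have "\<dots> = W y"
    unfolding inv_pos_def using y W_pos by (auto intro!: the_inv_into_f_f V_inj)
  finally show ?thesis
    using that y by auto
qed

lemma level_pos: "0 < a \<Longrightarrow> 0 < level a"
  using level_eq[of a] W_pos by metis

lemma level_nonneg: "0 \<le> a \<Longrightarrow> 0 \<le> level a"
  using level_pos[of a] level_0 by (cases "a = 0") auto

text \<open>
  Beyond its fixed point the tail bound lies below the level, because it decreases in \<open>u\<close>. This is
  the only source of convergence: the levels dominate the series of probabilities.
\<close>

lemma tail_bound_le_level:
  assumes "0 \<le> a" "level a \<le> u"
  shows "W (a / V u) \<le> level a"
proof (cases "a = 0")
  case False
  then obtain y where y: "0 < y" "level a = W y" "a = y * V (W y)"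
    using assms by (auto intro: level_eq[of a])
  have "0 < u"
    using y W_pos[of y] assms by linarith
  have "V (W y) \<le> V u"
    using y assms W_pos by (intro V_mono) auto
  then have "a / V u \<le> y"
    using y V_pos[OF \<open>0 < u\<close>] by (simp add: field_simps)
  moreover have "0 \<le> a / V u"
    using assms V_pos[OF \<open>0 < u\<close>] by simp
  ultimately show ?thesis
    using y W_mono by simp
qed (use level_0 W_0 in auto)

lemma tail_bound_nonneg:
  assumes "0 \<le> a" "0 \<le> u" "u = 0 \<Longrightarrow> a = 0"
  shows "0 \<le> W (a / V u)"
proof (cases "u = 0")
  case False
  then show ?thesis
    using assms V_pos[of u] by (intro W_nonneg) auto
qed (use assms W_0 in auto)

lemma tail_bound_antimono:
  assumes "0 \<le> a" "0 < u" "u \<le> u'"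
  shows "W (a / V u') \<le> W (a / V u)"
  using assms V_pos[of u] V_pos[of u'] V_mono[of u u']
  by (intro W_mono divide_left_mono divide_nonneg_pos mult_pos_pos) auto

lemma isCont_tail_bound:
  assumes "0 \<le> a" "0 \<le> p" "p = 0 \<Longrightarrow> a = 0" "0 < x"
  shows "isCont (\<lambda>y. W (a / V (p * y))) x"
proof (cases "a = 0")
  case True
  then show ?thesis
    by simp
next
  case False
  then have "0 < a" "p \<noteq> 0"
    using assms by auto
  then have pos: "0 < a" "0 < p * x"
    using assms by simp_all
  have "isCont (\<lambda>y. V (p * y)) x"
    using isCont_o2[of x "\<lambda>y. p * y" V] V_isCont[OF pos(2)] by simp
  then have "isCont (\<lambda>y. a / V (p * y)) x"
    using V_pos[OF pos(2)] by (intro continuous_intros) auto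
  then show ?thesis
    using isCont_o2[of x "\<lambda>y. a / V (p * y)" W] W_isCont[of "a / V (p * x)"] pos
      V_pos[OF pos(2)] by simp
qed

end

section \<open>Tails and norms in the space of random variables\<close>

locale VW_space = prob_space M + VW_pair V W
  for M :: "'w measure" and V W :: "real \<Rightarrow> real"
begin

lemma tail_measurable [measurable]:
  "\<xi> \<in> borel_measurable M \<Longrightarrow> {\<omega> \<in> space M. \<bar>\<xi> \<omega>\<bar> > (x::real)} \<in> sets M"
  by measurable

lemma D_measurable: "\<xi> \<in> D_VW M V W \<Longrightarrow> \<xi> \<in> borel_measurable M"
  by (simp add: D_VW_def)

lemma tail_weight_nonneg: "0 < x \<Longrightarrow> 0 \<le> tail_weight M V W \<xi> x"
  unfolding tail_weight_def using V_pos[of x] inv_W_nonneg by auto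

lemma D_bdd: "\<xi> \<in> D_VW M V W \<Longrightarrow> bdd_above (tail_weight M V W \<xi> ` {0<..})"
  unfolding D_VW_def by (auto elim!: bdd_above_mono)

lemma tail_weight_le_norm:
  assumes "\<xi> \<in> D_VW M V W" "0 < x"
  shows "tail_weight M V W \<xi> x \<le> (norm_VW M V W \<xi>)\<^sup>2"
proof -
  have le: "tail_weight M V W \<xi> x \<le> (SUP x\<in>{0<..}. tail_weight M V W \<xi> x)"
    using assms D_bdd by (intro cSUP_upper) auto
  then have "0 \<le> (SUP x\<in>{0<..}. tail_weight M V W \<xi> x)"
    using tail_weight_nonneg[OF assms(2), of \<xi>] by linarith
  then show ?thesis
    using le by (simp add: norm_VW_def)
qed

lemma norm_square_le:
  assumes "\<And>x. 0 < x \<Longrightarrow> tail_weight M V W \<xi> x \<le> B"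
  shows "(norm_VW M V W \<xi>)\<^sup>2 \<le> B"
proof -
  have B: "(SUP x\<in>{0<..}. tail_weight M V W \<xi> x) \<le> B"
    using assms by (intro cSUP_least) auto
  have "0 \<le> tail_weight M V W \<xi> 1"
    by (rule tail_weight_nonneg) simp
  also have "\<dots> \<le> (SUP x\<in>{0<..}. tail_weight M V W \<xi> x)"
    using assms by (intro cSUP_upper bdd_aboveI2) auto
  finally show ?thesis
    using B by (simp add: norm_VW_def)
qed

lemma norm_nonneg:
  assumes "\<xi> \<in> D_VW M V W"
  shows "0 \<le> norm_VW M V W \<xi>"
proof -
  have "0 \<le> tail_weight M V W \<xi> 1"
    by (rule tail_weight_nonneg) simp
  also have "\<dots> \<le> (SUP x\<in>{0<..}. tail_weight M V W \<xi> x)"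
    using D_bdd[OF assms] by (intro cSUP_upper) auto
  finally show ?thesis
    by (simp add: norm_VW_def)
qed

lemma D_VW_I:
  assumes "\<xi> \<in> borel_measurable M" "\<And>x. 0 < x \<Longrightarrow> tail_weight M V W \<xi> x \<le> B"
  shows "\<xi> \<in> D_VW M V W"
proof -
  have "tail_weight M V W \<xi> x \<le> max B (tail_weight M V W \<xi> 0)" if "x \<in> {0..}" for x
  proof (cases "x = 0")
    case False
    then have "0 < x"
      using that by simp
    from assms(2)[OF this] show ?thesis
      by simp
  qed simp
  then have "bdd_above (tail_weight M V W \<xi> ` {0..})"
    by (rule bdd_aboveI2)
  then show ?thesis
    using assms(1) unfolding D_VW_def by blast
qed

text \<open>
  The tail estimate that corresponds to the Chebyshev inequality: the definition of the norm bounds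
  \<open>W\<^sup>-\<^sup>1\<close> of the tail, and \<open>W\<close> is applied to both sides. At the threshold \<open>0\<close> it is used only when
  the norm vanishes; then every tail at a positive threshold is null, hence also the union of the
  tails at \<open>1 / Suc n\<close>.
\<close>

lemma tail_bound:
  assumes \<xi>: "\<xi> \<in> D_VW M V W" and a: "(norm_VW M V W \<xi>)\<^sup>2 \<le> a"
    and u: "0 \<le> u" "u = 0 \<Longrightarrow> a = 0"
  shows "prob {\<omega> \<in> space M. \<bar>\<xi> \<omega>\<bar> > u} \<le> W (a / V u)"
proof -
  have pos: "prob {\<omega> \<in> space M. \<bar>\<xi> \<omega>\<bar> > u} \<le> W (a / V u)" if "0 < u" for u
  proof -
    let ?p = "prob {\<omega> \<in> space M. \<bar>\<xi> \<omega>\<bar> > u}"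
    have "V u * inv_pos W ?p \<le> a"
      using tail_weight_le_norm[OF \<xi> that] a by (simp add: tail_weight_def)
    then have "inv_pos W ?p \<le> a / V u"
      using V_pos[OF that] by (simp add: field_simps)
    then have "W (inv_pos W ?p) \<le> W (a / V u)"
      by (intro W_mono inv_W_nonneg) auto
    then show ?thesis
      by (simp add: W_inv_W)
  qed
  show ?thesis
  proof (cases "u = 0")
    case True
    have [measurable]: "\<xi> \<in> borel_measurable M"
      using \<xi> by (rule D_measurable)
    have "AE \<omega> in M. \<bar>\<xi> \<omega>\<bar> \<le> 1 / Suc n" for n
    proof -
      have "prob {\<omega> \<in> space M. \<bar>\<xi> \<omega>\<bar> > 1 / Suc n} = 0"
        using pos[of "1 / Suc n"] u True W_0 by (intro antisym measure_nonneg) auto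
      then have "AE \<omega> in M. \<omega> \<notin> {\<omega> \<in> space M. \<bar>\<xi> \<omega>\<bar> > 1 / Suc n}"
        by (subst (asm) prob_eq_0) measurable
      then show ?thesis
        by (rule AE_mp) (auto intro!: AE_I2)
    qed
    then have "AE \<omega> in M. \<forall>n. \<bar>\<xi> \<omega>\<bar> \<le> 1 / Suc n"
      by (simp add: AE_all_countable)
    then have "AE \<omega> in M. \<omega> \<notin> {\<omega> \<in> space M. \<bar>\<xi> \<omega>\<bar> > 0}"
    proof (rule AE_mp, intro AE_I2 impI)
      fix \<omega> assume small: "\<forall>n. \<bar>\<xi> \<omega>\<bar> \<le> 1 / Suc n"
      have "\<not> 0 < \<bar>\<xi> \<omega>\<bar>"
        using small nat_approx_posE[of "\<bar>\<xi> \<omega>\<bar>"] by (metis not_le)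
      then show "\<omega> \<notin> {\<omega> \<in> space M. \<bar>\<xi> \<omega>\<bar> > 0}"
        by simp
    qed
    then have "prob {\<omega> \<in> space M. \<bar>\<xi> \<omega>\<bar> > 0} = 0"
      by (subst prob_eq_0) measurable
    then show ?thesis
      using True u W_0 by simp
  qed (use u pos in auto)
qed

text \<open>
  Condition (1) on \<open>W\<close> and condition (2) on \<open>V\<close>, taken at \<open>a = 2\<close>, make the space closed under
  sums: a sum exceeds \<open>x\<close> only if one of the two summands exceeds \<open>x / 2\<close>. The formulation by
  domination covers differences and maxima at the same time.
\<close>

lemma dominated_sum:
  obtains K where "0 \<le> K"
    "\<And>\<xi> \<eta> \<zeta>. \<lbrakk>\<xi> \<in> borel_measurable M; \<eta> \<in> D_VW M V W; \<zeta> \<in> D_VW M V W;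
       \<And>\<omega>. \<bar>\<xi> \<omega>\<bar> \<le> \<bar>\<eta> \<omega>\<bar> + \<bar>\<zeta> \<omega>\<bar>\<rbrakk> \<Longrightarrow>
       \<xi> \<in> D_VW M V W \<and>
       (norm_VW M V W \<xi>)\<^sup>2 \<le> K * ((norm_VW M V W \<eta>)\<^sup>2 + (norm_VW M V W \<zeta>)\<^sup>2)"
proof -
  obtain C where C: "C > 0"
    "\<And>p q. 0 \<le> p \<Longrightarrow> 0 \<le> q \<Longrightarrow> inv_pos W (p + q) \<le> C * (inv_pos W p + inv_pos W q)"
    using inv_W_quasi_subadditive by blast
  have "\<exists>Z. continuous_on {0<..} Z \<and> (\<forall>a>0. 0 < Z a) \<and>
      (\<forall>a>0. \<forall>x>0. V (a * x) \<le> Z a * V x)"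
    using admissible unfolding admissible_pair_def by (elim conjE)
  then obtain Z where Z: "\<And>a. a > 0 \<Longrightarrow> 0 < Z a"
      "\<And>a x. a > 0 \<Longrightarrow> x > 0 \<Longrightarrow> V (a * x) \<le> Z a * V x"
    by blast
  have Z2: "0 < Z 2" and V2: "\<And>x. 0 < x \<Longrightarrow> V x \<le> Z 2 * V (x / 2)"
    using Z(1)[of 2] Z(2)[of 2 "x / 2" for x] by auto
  have bound: "tail_weight M V W \<xi> x
      \<le> (Z 2 * C) * ((norm_VW M V W \<eta>)\<^sup>2 + (norm_VW M V W \<zeta>)\<^sup>2)"
    if \<xi>[measurable]: "\<xi> \<in> borel_measurable M" and \<eta>: "\<eta> \<in> D_VW M V W" and \<zeta>: "\<zeta> \<in> D_VW M V W"
      and le: "\<And>\<omega>. \<bar>\<xi> \<omega>\<bar> \<le> \<bar>\<eta> \<omega>\<bar> + \<bar>\<zeta> \<omega>\<bar>" and x: "0 < x" for \<xi> \<eta> \<zeta> x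
  proof -
    have [measurable]: "\<eta> \<in> borel_measurable M" "\<zeta> \<in> borel_measurable M"
      using \<eta> \<zeta> by (auto intro: D_measurable)
    let ?A = "\<lambda>\<xi> x. {\<omega> \<in> space M. \<bar>\<xi> \<omega>\<bar> > x}"
    let ?p = "prob (?A \<eta> (x / 2))" and ?q = "prob (?A \<zeta> (x / 2))"
    have "?A \<xi> x \<subseteq> ?A \<eta> (x / 2) \<union> ?A \<zeta> (x / 2)"
    proof
      fix \<omega> assume "\<omega> \<in> ?A \<xi> x"
      then show "\<omega> \<in> ?A \<eta> (x / 2) \<union> ?A \<zeta> (x / 2)"
        using le[of \<omega>] by auto
    qed
    then have "prob (?A \<xi> x) \<le> prob (?A \<eta> (x / 2) \<union> ?A \<zeta> (x / 2))"
      by (intro finite_measure_mono) auto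
    also have "\<dots> \<le> ?p + ?q"
      by (intro measure_Un_le) auto
    finally have "inv_pos W (prob (?A \<xi> x)) \<le> inv_pos W (?p + ?q)"
      by (intro inv_W_mono) auto
    also have "\<dots> \<le> C * (inv_pos W ?p + inv_pos W ?q)"
      by (intro C) auto
    finally have i: "inv_pos W (prob (?A \<xi> x)) \<le> C * (inv_pos W ?p + inv_pos W ?q)" .
    have "tail_weight M V W \<xi> x \<le> (Z 2 * V (x / 2)) * (C * (inv_pos W ?p + inv_pos W ?q))"
      unfolding tail_weight_def using x Z2 V_pos[of "x / 2"]
      by (intro mult_mono V2 i inv_W_nonneg) auto
    also have "\<dots> = (Z 2 * C) * (tail_weight M V W \<eta> (x / 2) + tail_weight M V W \<zeta> (x / 2))"
      by (simp add: tail_weight_def algebra_simps)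
    also have "\<dots> \<le> (Z 2 * C) * ((norm_VW M V W \<eta>)\<^sup>2 + (norm_VW M V W \<zeta>)\<^sup>2)"
      using Z2 C x by (intro mult_left_mono add_mono tail_weight_le_norm \<eta> \<zeta>) auto
    finally show ?thesis .
  qed
  show ?thesis
  proof (rule that[of "Z 2 * C"])
    show "0 \<le> Z 2 * C"
      using Z2 C by simp
  qed (use bound D_VW_I norm_square_le in meson)
qed

lemma diff_in_D:
  assumes "\<xi> \<in> D_VW M V W" "\<eta> \<in> D_VW M V W"
  shows "(\<lambda>\<omega>. \<xi> \<omega> - \<eta> \<omega>) \<in> D_VW M V W"
proof -
  have [measurable]: "\<xi> \<in> borel_measurable M" "\<eta> \<in> borel_measurable M"
    using assms by (auto intro: D_measurable)
  have m: "(\<lambda>\<omega>. \<xi> \<omega> - \<eta> \<omega>) \<in> borel_measurable M"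
    by measurable
  show ?thesis
    by (rule dominated_sum) (use m assms abs_triangle_ineq4 in blast)
qed

lemma Max_abs_in_D:
  fixes \<xi> :: "nat \<Rightarrow> 'w \<Rightarrow> real"
  assumes "\<forall>i\<in>{1..Suc n}. \<xi> i \<in> D_VW M V W"
  shows "(\<lambda>\<omega>. MAX i\<in>{1..Suc n}. \<bar>\<xi> i \<omega>\<bar>) \<in> D_VW M V W"
proof -
  obtain K where K: "\<And>\<xi> \<eta> \<zeta>. \<lbrakk>\<xi> \<in> borel_measurable M; \<eta> \<in> D_VW M V W; \<zeta> \<in> D_VW M V W;
       \<And>\<omega>. \<bar>\<xi> \<omega>\<bar> \<le> \<bar>\<eta> \<omega>\<bar> + \<bar>\<zeta> \<omega>\<bar>\<rbrakk> \<Longrightarrow> \<xi> \<in> D_VW M V W"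
    using dominated_sum by metis
  show ?thesis
    using assms
  proof (induction n)
    case 0
    then have "\<xi> 1 \<in> D_VW M V W"
      by auto
    moreover from D_measurable[OF this] have "(\<lambda>\<omega>. \<bar>\<xi> 1 \<omega>\<bar>) \<in> borel_measurable M"
      by measurable
    ultimately have "(\<lambda>\<omega>. \<bar>\<xi> 1 \<omega>\<bar>) \<in> D_VW M V W"
      by (intro K[of "\<lambda>\<omega>. \<bar>\<xi> 1 \<omega>\<bar>" "\<xi> 1" "\<xi> 1"]) auto
    then show ?case
      by simp
  next
    case (Suc n)
    let ?m = "\<lambda>\<omega>. MAX i\<in>{1..Suc n}. \<bar>\<xi> i \<omega>\<bar>"
    have IH: "?m \<in> D_VW M V W"
      using Suc by auto
    have last: "\<xi> (Suc (Suc n)) \<in> D_VW M V W"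
      using Suc.prems by auto
    have "{1..Suc (Suc n)} = insert (Suc (Suc n)) {1..Suc n}"
      by auto
    then have eq: "(\<lambda>\<omega>. MAX i\<in>{1..Suc (Suc n)}. \<bar>\<xi> i \<omega>\<bar>) = (\<lambda>\<omega>. max \<bar>\<xi> (Suc (Suc n)) \<omega>\<bar> (?m \<omega>))"
      by simp
    have m: "(\<lambda>\<omega>. max \<bar>\<xi> (Suc (Suc n)) \<omega>\<bar> (?m \<omega>)) \<in> borel_measurable M"
      using D_measurable[OF IH] D_measurable[OF last] by measurable
    have "\<bar>max \<bar>p\<bar> q\<bar> \<le> \<bar>p\<bar> + \<bar>q\<bar>" for p q :: real
      by (auto simp: max_def)
    then show ?case
      unfolding eq by (intro K[OF m last IH])
  qed
qed

text \<open>
  A majorizing characteristic turns the union over a finite net into a single application of the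
  tail estimate, to the maximum over the net, whose norm it bounds by \<open>\<kappa> (card F) * e\<close>.
\<close>

lemma finite_sup_tail_bound:
  assumes \<kappa>: "majorizing_characteristic M V W \<kappa>"
    and F: "finite F" "F \<noteq> {}" and \<xi>: "\<And>t. t \<in> F \<Longrightarrow> \<xi> t \<in> D_VW M V W"
    and e: "\<And>t. t \<in> F \<Longrightarrow> norm_VW M V W (\<xi> t) \<le> e"
    and u: "0 \<le> u" "u = 0 \<Longrightarrow> (\<kappa> (card F))\<^sup>2 * e\<^sup>2 = 0"
  shows "prob {\<omega> \<in> space M. \<exists>t\<in>F. \<bar>\<xi> t \<omega>\<bar> > u} \<le> W ((\<kappa> (card F))\<^sup>2 * e\<^sup>2 / V u)"
proof -
  obtain n where n: "card F = Suc n"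
    using F by (metis card_gt_0_iff gr0_implies_Suc)
  obtain g where g: "bij_betw g {1..Suc n} F"
    using ex_bij_betw_nat_finite_1[OF F(1)] n by auto
  then have gF: "g i \<in> F" if "i \<in> {1..Suc n}" for i
    using that by (auto simp: bij_betw_def)
  let ?m = "\<lambda>\<omega>. MAX i\<in>{1..Suc n}. \<bar>\<xi> (g i) \<omega>\<bar>"
  let ?r = "MAX i\<in>{1..Suc n}. norm_VW M V W (\<xi> (g i))"
  have mD: "?m \<in> D_VW M V W"
    using gF \<xi> by (intro Max_abs_in_D) blast
  have le: "norm_VW M V W ?m \<le> \<kappa> (Suc n) * ?r"
  proof -
    have "\<forall>i\<in>{1..Suc n}. \<xi> (g i) \<in> D_VW M V W"
      using gF \<xi> by blast
    then show ?thesis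
      using \<kappa>[unfolded majorizing_characteristic_def, THEN conjunct2, rule_format,
          of "Suc n" "\<lambda>i. \<xi> (g i)"] by simp
  qed
  have r: "?r \<in> (\<lambda>i. norm_VW M V W (\<xi> (g i))) ` {1..Suc n}"
    by (intro Max_in) auto
  then have "0 \<le> ?r" "?r \<le> e"
    using gF \<xi> e norm_nonneg by fastforce+
  have "(norm_VW M V W ?m)\<^sup>2 \<le> (\<kappa> (Suc n) * ?r)\<^sup>2"
    using le norm_nonneg[OF mD] by (intro power_mono)
  also have "\<dots> \<le> (\<kappa> (Suc n))\<^sup>2 * e\<^sup>2"
    unfolding power_mult_distrib using \<open>0 \<le> ?r\<close> \<open>?r \<le> e\<close>
    by (intro mult_left_mono power_mono) auto
  finally have "(norm_VW M V W ?m)\<^sup>2 \<le> (\<kappa> (card F))\<^sup>2 * e\<^sup>2"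
    using n by simp
  then have "prob {\<omega> \<in> space M. \<bar>?m \<omega>\<bar> > u} \<le> W ((\<kappa> (card F))\<^sup>2 * e\<^sup>2 / V u)"
    using u by (intro tail_bound mD) auto
  moreover have "(\<exists>t\<in>F. \<bar>\<xi> t \<omega>\<bar> > u) \<longleftrightarrow> \<bar>?m \<omega>\<bar> > u" for \<omega>
  proof -
    have "0 \<le> \<bar>\<xi> (g 1) \<omega>\<bar>" "\<bar>\<xi> (g 1) \<omega>\<bar> \<le> ?m \<omega>"
      by (auto intro!: Max_ge)
    then have "\<bar>?m \<omega>\<bar> = ?m \<omega>"
      by linarith
    moreover have "?m \<omega> > u \<longleftrightarrow> (\<exists>i\<in>{1..Suc n}. \<bar>\<xi> (g i) \<omega>\<bar> > u)"
      by (subst Max_gr_iff) auto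
    moreover have "F = g ` {1..Suc n}"
      using g by (simp add: bij_betw_def)
    ultimately show ?thesis
      by simp
  qed
  ultimately show ?thesis
    by simp
qed

section \<open>Chaining along finite nets\<close>

text \<open>
  Each point of a net is joined to the starting point by descending through the coarser nets, one
  step per level. Only the increments from a point to its chosen approximation one level below
  enter, which is why a premetric suffices to control them.
\<close>

lemma chain_telescope:
  fixes Y :: "'t \<Rightarrow> real"
  assumes "S 0 = {t0}" "\<bar>Y t0\<bar> \<le> u 0"
    and "\<And>k t. t \<in> S (Suc k) \<Longrightarrow> \<alpha> k t \<in> S k"
    and "\<And>k t. t \<in> S (Suc k) \<Longrightarrow> \<bar>Y t - Y (\<alpha> k t)\<bar> \<le> u (Suc k)"
    and "t \<in> S n"
  shows "\<bar>Y t\<bar> \<le> (\<Sum>k\<le>n. u k)"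
  using assms(5)
proof (induction n arbitrary: t)
  case 0
  then show ?case
    using assms(1,2) by auto
next
  case (Suc n)
  have "\<bar>Y (\<alpha> n t)\<bar> \<le> (\<Sum>k\<le>n. u k)"
    using Suc.IH assms(3) Suc.prems by blast
  then show ?case
    using assms(4)[OF Suc.prems] by simp
qed

text \<open>
  If no increment of level \<open>k\<close> exceeds its threshold \<open>u k\<close>, then \<open>chain_telescope\<close> keeps the whole
  process below \<open>\<Sum>k. u k\<close>, hence strictly below \<open>x\<close>. The strict inequality is what permits the closed
  event \<open>\<ge> x\<close> on the left.
\<close>

lemma chain_union_bound:
  fixes X :: "'t \<Rightarrow> 'w \<Rightarrow> real"
  assumes \<kappa>: "majorizing_characteristic M V W \<kappa>"
    and X: "\<And>t. t \<in> T \<Longrightarrow> X t \<in> D_VW M V W"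
    and S: "\<And>k. finite (S k)" "\<And>k. S k \<noteq> {}" "\<And>k. S k \<subseteq> T" "S 0 = {t0}"
    and \<alpha>: "\<And>k t. t \<in> S (Suc k) \<Longrightarrow> \<alpha> k t \<in> S k"
      "\<And>k t. t \<in> S (Suc k) \<Longrightarrow> norm_VW M V W (\<lambda>\<omega>. X t \<omega> - X (\<alpha> k t) \<omega>) \<le> e k"
    and b: "\<And>k. b k = (\<kappa> (card (S (Suc k))))\<^sup>2 * (e k)\<^sup>2"
    and u: "\<And>k. 0 \<le> u k" "0 < u 0" "\<And>k. u (Suc k) = 0 \<Longrightarrow> b k = 0"
    and sum_u: "summable u" "suminf u < x"
    and sum_b: "summable (\<lambda>k. W (b k / V (u (Suc k))))"
  shows "prob {\<omega> \<in> space M. (SUP t\<in>(\<Union>k. S (Suc k)). ereal \<bar>X t \<omega>\<bar>) \<ge> ereal x}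
    \<le> W ((norm_VW M V W (X t0))\<^sup>2 / V (u 0)) + (\<Sum>k. W (b k / V (u (Suc k))))"
proof -
  have t0: "t0 \<in> T"
    using S(3)[of 0] S(4) by auto
  have meas: "X t \<in> borel_measurable M" if "t \<in> T" for t
    using X[OF that] by (rule D_measurable)
  define A where "A = (\<lambda>k. {\<omega> \<in> space M. \<exists>t\<in>S (Suc k). \<bar>X t \<omega> - X (\<alpha> k t) \<omega>\<bar> > u (Suc k)})"
  define B where "B = {\<omega> \<in> space M. \<bar>X t0 \<omega>\<bar> > u 0}"
  let ?E = "{\<omega> \<in> space M. (SUP t\<in>(\<Union>k. S (Suc k)). ereal \<bar>X t \<omega>\<bar>) \<ge> ereal x}"
  have in_T: "t \<in> T" "\<alpha> k t \<in> T" if "t \<in> S (Suc k)" for t k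
    using that S(3) \<alpha>(1) by blast+
  have A_sets: "A k \<in> sets M" for k
  proof -
    have "{\<omega> \<in> space M. \<bar>X t \<omega> - X (\<alpha> k t) \<omega>\<bar> > u (Suc k)} \<in> sets M" if "t \<in> S (Suc k)" for t
    proof -
      have [measurable]: "X t \<in> borel_measurable M" "X (\<alpha> k t) \<in> borel_measurable M"
        using in_T[OF that] meas by blast+
      show ?thesis
        by measurable
    qed
    then have "(\<Union>t\<in>S (Suc k). {\<omega> \<in> space M. \<bar>X t \<omega> - X (\<alpha> k t) \<omega>\<bar> > u (Suc k)}) \<in> sets M"
      by (intro sets.finite_UN S) auto
    also have "(\<Union>t\<in>S (Suc k). {\<omega> \<in> space M. \<bar>X t \<omega> - X (\<alpha> k t) \<omega>\<bar> > u (Suc k)}) = A k"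
      by (auto simp: A_def)
    finally show ?thesis .
  qed
  have B_sets: "B \<in> sets M"
    unfolding B_def by (intro tail_measurable meas t0)
  have A_le: "prob (A k) \<le> W (b k / V (u (Suc k)))" for k
    unfolding A_def b
  proof (rule finite_sup_tail_bound[OF \<kappa> S(1,2)])
    show "(\<lambda>\<omega>. X t \<omega> - X (\<alpha> k t) \<omega>) \<in> D_VW M V W" if "t \<in> S (Suc k)" for t
      using in_T[OF that] X by (intro diff_in_D)
  qed (use \<alpha>(2) u b in auto)
  have B_le: "prob B \<le> W ((norm_VW M V W (X t0))\<^sup>2 / V (u 0))"
    unfolding B_def using u(2) by (intro tail_bound X t0) auto
  have sum_A: "summable (\<lambda>k. prob (A k))"
    using A_le by (intro summable_comparison_test'[OF sum_b]) auto
  have sub: "?E \<subseteq> B \<union> (\<Union>k. A k)"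
  proof (rule subsetI, rule ccontr)
    fix \<omega> assume E: "\<omega> \<in> ?E" and no: "\<omega> \<notin> B \<union> (\<Union>k. A k)"
    have "\<bar>X t \<omega>\<bar> \<le> suminf u" if "t \<in> S n" for t n
    proof -
      have "\<bar>X t0 \<omega>\<bar> \<le> u 0"
        using E no by (auto simp: B_def)
      moreover have "\<bar>X t \<omega> - X (\<alpha> k t) \<omega>\<bar> \<le> u (Suc k)" if "t \<in> S (Suc k)" for k t
        using E no that by (force simp: A_def)
      ultimately have "\<bar>X t \<omega>\<bar> \<le> (\<Sum>k\<le>n. u k)"
        using chain_telescope[of S t0 "\<lambda>t. X t \<omega>" u \<alpha> t n] S(4) \<alpha>(1) that by blast
      also have "\<dots> \<le> suminf u"
        using u(1) by (intro sum_le_suminf sum_u) auto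
      finally show ?thesis .
    qed
    then have "(SUP t\<in>(\<Union>k. S (Suc k)). ereal \<bar>X t \<omega>\<bar>) \<le> ereal (suminf u)"
      by (intro SUP_least) auto
    moreover have "ereal x \<le> (SUP t\<in>(\<Union>k. S (Suc k)). ereal \<bar>X t \<omega>\<bar>)"
      using E by blast
    ultimately have "ereal x \<le> ereal (suminf u)"
      by (rule order_trans[rotated])
    then show False
      using sum_u(2) by simp
  qed
  have "prob ?E \<le> prob (B \<union> (\<Union>k. A k))"
    using A_sets B_sets by (intro finite_measure_mono[OF sub] sets.Un sets.countable_UN) auto
  also have "\<dots> \<le> prob B + prob (\<Union>k. A k)"
    using A_sets B_sets by (intro measure_Un_le sets.countable_UN) auto
  also have "prob (\<Union>k. A k) \<le> (\<Sum>k. prob (A k))"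
    using A_sets by (intro finite_measure_subadditive_countably sum_A) auto
  also have "(\<Sum>k. prob (A k)) \<le> (\<Sum>k. W (b k / V (u (Suc k))))"
    by (intro suminf_le A_le sum_A sum_b)
  finally show ?thesis
    using B_le by simp
qed

end

section \<open>Minimal covers\<close>

lemma closed_ball_coverD:
  assumes "closed_ball_cover T \<rho> r F"
  shows "finite F" "F \<subseteq> T" "T \<noteq> {} \<Longrightarrow> F \<noteq> {}" "\<And>t. t \<in> T \<Longrightarrow> \<exists>c\<in>F. \<rho> c t \<le> r"
  using assms by (auto simp: closed_ball_cover_def)

lemma minimal_cover:
  assumes "\<exists>F. closed_ball_cover T \<rho> r F"
  shows "\<exists>F. closed_ball_cover T \<rho> r F \<and> card F = covering_number T \<rho> r"
  unfolding covering_number_def by (rule LeastI_ex) (use assms in auto)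

lemma dense_in_union_of_covers:
  assumes cover: "\<And>k. closed_ball_cover T \<rho> (r k) (F k)" and r: "r \<longlonglongrightarrow> 0"
    and sym: "\<And>s t. \<rho> s t = \<rho> t s"
  shows "dense_in T \<rho> (\<Union>k. F k)"
  unfolding dense_in_def
proof (intro conjI ballI allI impI)
  show "(\<Union>k. F k) \<subseteq> T"
    using closed_ball_coverD(2)[OF cover] by blast
  fix t and e :: real assume "t \<in> T" "0 < e"
  then obtain k where "r k < e"
    using order_tendstoD(2)[OF r] by (meson eventually_sequentially order_refl)
  moreover obtain c where "c \<in> F k" "\<rho> c t \<le> r k"
    using closed_ball_coverD(4)[OF cover \<open>t \<in> T\<close>] by blast
  ultimately show "\<exists>s\<in>\<Union>k. F k. \<rho> t s < e"
    using sym[of c t] by (auto intro!: bexI[of _ c])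
qed

section \<open>The tail of the supremum\<close>

theorem theorem7p2:
  fixes M :: "'w measure" and V W f :: "real \<Rightarrow> real"
    and T :: "'t set" and X :: "'t \<Rightarrow> 'w \<Rightarrow> real" and \<rho> :: "'t \<Rightarrow> 't \<Rightarrow> real"
    and \<kappa> :: "nat \<Rightarrow> real" and N :: "real \<Rightarrow> nat" and \<epsilon> a v \<psi> :: "nat \<Rightarrow> real"
    and \<theta> \<Psi> x :: real
  assumes "prob_space M"
    and "admissible_pair V W"
    and "T \<noteq> {}"
    and "\<And>t. t \<in> T \<Longrightarrow> X t \<in> D_VW M V W"
    and "\<rho> = (\<lambda>t s. norm_VW M V W (\<lambda>\<omega>. X t \<omega> - X s \<omega>))"
    and A1: "bdd_above ((\<lambda>t. norm_VW M V W (X t)) ` T)"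
    and A2: "premetric_separable T \<rho>" "separable_process M T \<rho> X"
    and "0 < \<theta>" "\<theta> < 1"
    and "\<epsilon> = (\<lambda>k. (SUP (t, s)\<in>T \<times> T. \<rho> t s) * \<theta> ^ k)"
    and "N = covering_number T \<rho>"
    and N_finite: "\<And>n. n \<ge> 1 \<Longrightarrow> \<exists>F. closed_ball_cover T \<rho> (\<epsilon> n) F"
    and "majorizing_characteristic M V W \<kappa>"
    and "f = (\<lambda>y. y * V (W y))"
    and "a = (\<lambda>k. if k = 0 then (INF t\<in>T. (norm_VW M V W (X t))\<^sup>2)
                  else (\<kappa> (N (\<epsilon> k)))\<^sup>2 * (\<epsilon> (k - 1))\<^sup>2)"
    and "v = (\<lambda>k. inv_pos V (a k / inv_pos f (a k)))"
    and "summable (\<lambda>n. v (Suc n))"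
    and "\<Psi> = v 0 + (\<Sum>k. v (Suc k))"
    and "\<psi> = (\<lambda>k. 1 / \<Psi> * v k)"
    and "x > \<Psi>"
  shows "measure (completion M) {\<omega> \<in> space M. (SUP t\<in>T. ereal \<bar>X t \<omega>\<bar>) \<ge> ereal x}
           \<le> W (a 0 / V (\<psi> 0 * x)) + (\<Sum>k. W (a (Suc k) / V (\<psi> (Suc k) * x)))"
proof -
  interpret VW_space M V W
    using assms(1,2) by (simp add: VW_space_def VW_pair_def)
  note X = assms(4) and \<rho> = assms(5) and \<epsilon> = assms(11) and \<kappa> = assms(14)
  let ?n = "\<lambda>t. norm_VW M V W (X t)"
  let ?E = "{\<omega> \<in> space M. (SUP t\<in>T. ereal \<bar>X t \<omega>\<bar>) \<ge> ereal x}"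

  have a_nonneg: "0 \<le> a k" for k
    using \<open>T \<noteq> {}\<close> by (auto simp: assms(16) intro!: cINF_greatest)
  have v_level: "v k = level (a k)" for k
    by (simp add: assms(15,17) level_def)
  have v_nonneg: "0 \<le> v k" for k
    using a_nonneg level_nonneg v_level by simp
  have v_pos: "0 < v k" if "a k \<noteq> 0" for k
    using that a_nonneg[of k] level_pos v_level by simp
  have v_summable: "summable v"
    using assms(18) by (simp add: summable_Suc_iff)
  have \<Psi>: "\<Psi> = suminf v"
    using suminf_split_head[OF v_summable] assms(19) by simp
  have v_le: "v k \<le> \<Psi>" for k
    unfolding \<Psi> using sum_le_suminf[OF v_summable, of "{k}"] v_nonneg by simp
  have \<Psi>_nonneg: "0 \<le> \<Psi>"
    using v_le[of 0] v_nonneg[of 0] by linarith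
  have \<psi>_nonneg: "0 \<le> \<psi> k" for k
    using v_nonneg \<Psi>_nonneg by (simp add: assms(20))
  have \<psi>_0: "a k = 0" if "\<psi> k = 0" for k
  proof (rule ccontr)
    assume "a k \<noteq> 0"
    then have "0 < v k" "0 < \<Psi>"
      using v_pos[of k] v_le[of k] by auto
    then show False
      using that by (simp add: assms(20))
  qed
  have \<psi>_summable: "summable \<psi>"
    unfolding assms(20) by (intro summable_mult v_summable)
  \<comment> \<open>The sum is \<open>1\<close>, except that it is \<open>0\<close> when all levels vanish.\<close>
  have \<psi>_sum: "suminf \<psi> \<le> 1"
    unfolding assms(20) using suminf_mult[OF v_summable, of "1 / \<Psi>"] \<Psi> by simp
  have v_le_\<psi>: "v k \<le> \<psi> k * y" if "\<Psi> \<le> y" for k y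
  proof (cases "\<Psi> = 0")
    case True
    then show ?thesis
      using v_le[of k] v_nonneg[of k] by (simp add: assms(20))
  next
    case False
    then have "v k * \<Psi> \<le> v k * y"
      using that v_nonneg by (intro mult_left_mono)
    then show ?thesis
      using False \<Psi>_nonneg by (simp add: assms(20) field_simps)
  qed
  define g where "g = (\<lambda>k y. W (a k / V (\<psi> k * y)))"
  have g_le: "g k y \<le> v k" if "\<Psi> \<le> y" for k y
    unfolding g_def v_level using a_nonneg v_le_\<psi>[OF that, of k] v_level
    by (intro tail_bound_le_level) auto
  have g_nonneg: "0 \<le> g k y" if "0 < y" for k y
    unfolding g_def using a_nonneg \<psi>_nonneg \<psi>_0 that by (intro tail_bound_nonneg) auto
  have g_summable: "summable (\<lambda>k. g (Suc k) y)" if "\<Psi> < y" for y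
    using g_le g_nonneg that \<Psi>_nonneg
    by (intro summable_comparison_test'[OF assms(18)]) auto

  \<comment> \<open>The premetric is bounded because the space is closed under differences; otherwise the
    supremum that defines \<open>\<epsilon> 0\<close> would bound nothing.\<close>
  have \<rho>_bdd: "bdd_above ((\<lambda>(t, s). \<rho> t s) ` (T \<times> T))"
  proof -
    obtain B where B: "\<And>t. t \<in> T \<Longrightarrow> ?n t \<le> B"
      using A1 by (auto simp: bdd_above_def)
    obtain K where K: "0 \<le> K" "\<And>\<xi> \<eta> \<zeta>. \<lbrakk>\<xi> \<in> borel_measurable M; \<eta> \<in> D_VW M V W; \<zeta> \<in> D_VW M V W;
       \<And>\<omega>. \<bar>\<xi> \<omega>\<bar> \<le> \<bar>\<eta> \<omega>\<bar> + \<bar>\<zeta> \<omega>\<bar>\<rbrakk> \<Longrightarrow> \<xi> \<in> D_VW M V W \<and>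
       (norm_VW M V W \<xi>)\<^sup>2 \<le> K * ((norm_VW M V W \<eta>)\<^sup>2 + (norm_VW M V W \<zeta>)\<^sup>2)"
      using dominated_sum by blast
    have "\<rho> t s \<le> sqrt (K * (B\<^sup>2 + B\<^sup>2))" if ts: "t \<in> T" "s \<in> T" for t s
    proof -
      have "(\<rho> t s)\<^sup>2 \<le> K * ((?n t)\<^sup>2 + (?n s)\<^sup>2)"
        unfolding \<rho> using X[OF ts(1)] X[OF ts(2)] diff_in_D D_measurable abs_triangle_ineq4
        by (intro K(2)[THEN conjunct2]) blast+
      also have "\<dots> \<le> K * (B\<^sup>2 + B\<^sup>2)"
        using K(1) B ts X norm_nonneg by (intro mult_left_mono add_mono power_mono) auto
      finally show ?thesis
        by (rule real_le_rsqrt)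
    qed
    then show ?thesis
      by (intro bdd_aboveI2[where M = "sqrt (K * (B\<^sup>2 + B\<^sup>2))"]) auto
  qed
  have \<rho>_le: "\<rho> t s \<le> \<epsilon> 0" if "t \<in> T" "s \<in> T" for t s
    using cSUP_upper[OF _ \<rho>_bdd, of "(t, s)"] that by (simp add: \<epsilon>)
  have \<rho>_sym: "\<rho> t s = \<rho> s t" for t s
  proof -
    have "tail_weight M V W (\<lambda>\<omega>. X t \<omega> - X s \<omega>) = tail_weight M V W (\<lambda>\<omega>. X s \<omega> - X t \<omega>)"
      by (simp add: tail_weight_def fun_eq_iff abs_minus_commute)
    then show ?thesis
      by (simp add: \<rho> norm_VW_def)
  qed

  have "\<exists>F. closed_ball_cover T \<rho> (\<epsilon> (Suc k)) F \<and> card F = N (\<epsilon> (Suc k))" for k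
    unfolding assms(12) by (intro minimal_cover N_finite) simp
  then obtain F where F: "\<And>k. closed_ball_cover T \<rho> (\<epsilon> (Suc k)) (F k)"
      "\<And>k. card (F k) = N (\<epsilon> (Suc k))"
    by metis
  let ?S = "\<Union>k. F k"
  have "(\<lambda>k. \<epsilon> (Suc k)) \<longlonglongrightarrow> 0"
  proof -
    have "\<epsilon> \<longlonglongrightarrow> (SUP (t, s)\<in>T \<times> T. \<rho> t s) * 0"
      unfolding \<epsilon> using assms(9,10) by (intro tendsto_mult tendsto_const LIMSEQ_power_zero) auto
    then show ?thesis
      by (simp add: LIMSEQ_Suc)
  qed
  then have "dense_in T \<rho> ?S"
    using F(1) \<rho>_sym by (intro dense_in_union_of_covers)
  moreover have "countable ?S"
    using closed_ball_coverD(1)[OF F(1)] by (auto intro: countable_finite)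
  ultimately have AE_eq: "AE \<omega> in M. (SUP t\<in>T. ereal \<bar>X t \<omega>\<bar>) = (SUP t\<in>?S. ereal \<bar>X t \<omega>\<bar>)"
    using A2(2) unfolding separable_process_def by blast

  let ?ES = "{\<omega> \<in> space M. (SUP t\<in>?S. ereal \<bar>X t \<omega>\<bar>) \<ge> ereal x}"
  have ES: "?ES \<in> sets M"
  proof -
    have "(\<lambda>\<omega>. SUP t\<in>?S. ereal \<bar>X t \<omega>\<bar>) \<in> borel_measurable M"
      using closed_ball_coverD(2)[OF F(1)] X D_measurable \<open>countable ?S\<close>
      by (intro borel_measurable_SUP borel_measurable_ereal borel_measurable_abs) blast+
    then show ?thesis
      by measurable
  qed
  have E_le: "measure (completion M) ?E \<le> prob ?ES"
  proof -
    interpret C: prob_space "completion M"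
      by (rule prob_space_completion)
    have "AE \<omega> in completion M. \<omega> \<in> ?E \<longrightarrow> \<omega> \<in> ?ES"
      using AE_completion[OF AE_eq] by eventually_elim auto
    then have "measure (completion M) ?E \<le> measure (completion M) ?ES"
      using ES by (intro C.finite_measure_mono_AE) auto
    then show ?thesis
      using ES by simp
  qed

  \<comment> \<open>The thresholds are \<open>\<psi> k * y\<close>, and the starting level gets the extra \<open>d\<close>, which keeps its
    threshold positive when \<open>\<psi> 0 = 0\<close>.\<close>
  have step: "prob ?ES \<le> W ((?n t0)\<^sup>2 / V (\<psi> 0 * y + d)) + (\<Sum>k. g (Suc k) y)"
    if t0: "t0 \<in> T" and y: "\<Psi> < y" and d: "0 < d" "y + d < x" for t0 y d
  proof -
    define S where "S = (\<lambda>k. case k of 0 \<Rightarrow> {t0} | Suc j \<Rightarrow> F j)"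
    define u where "u = (\<lambda>k. \<psi> k * y + (if k = 0 then d else 0))"
    have y_pos: "0 < y"
      using y \<Psi>_nonneg by simp
    have S_simps: "S 0 = {t0}" "\<And>k. S (Suc k) = F k"
      by (auto simp: S_def)
    have S: "finite (S k)" "S k \<noteq> {}" "S k \<subseteq> T" for k
      using closed_ball_coverD(1-3)[OF F(1)] t0 \<open>T \<noteq> {}\<close> by (cases k; simp add: S_simps)+
    have "\<exists>s\<in>S k. \<rho> t s \<le> \<epsilon> k" if "t \<in> S (Suc k)" for k t
    proof -
      have tT: "t \<in> T"
        using that S(3) by blast
      show ?thesis
      proof (cases k)
        case 0
        then show ?thesis
          using \<rho>_le[OF tT t0] by (simp add: S_simps)
      next
        case (Suc j)
        then show ?thesis
          using closed_ball_coverD(4)[OF F(1) tT, of j] \<rho>_sym by (auto simp: S_simps)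
      qed
    qed
    then have "\<forall>k t. \<exists>s. t \<in> S (Suc k) \<longrightarrow> s \<in> S k \<and> \<rho> t s \<le> \<epsilon> k"
      by blast
    then obtain \<alpha> where \<alpha>: "\<And>k t. t \<in> S (Suc k) \<Longrightarrow> \<alpha> k t \<in> S k"
        "\<And>k t. t \<in> S (Suc k) \<Longrightarrow> \<rho> t (\<alpha> k t) \<le> \<epsilon> k"
      by metis
    have u_sums: "u sums (suminf \<psi> * y + d)"
      unfolding u_def
      by (intro sums_add sums_mult2 summable_sums[OF \<psi>_summable])
         (use sums_single[of 0 "\<lambda>_. d"] in simp)
    have "suminf \<psi> * y \<le> 1 * y"
      using \<psi>_sum y_pos by (intro mult_right_mono) auto
    then have u_lt: "suminf u < x"
      using u_sums d by (simp add: sums_unique[symmetric])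
    have u_Suc: "u (Suc k) = \<psi> (Suc k) * y" for k
      by (simp add: u_def)
    have "prob {\<omega> \<in> space M. (SUP t\<in>(\<Union>k. S (Suc k)). ereal \<bar>X t \<omega>\<bar>) \<ge> ereal x}
      \<le> W ((?n t0)\<^sup>2 / V (u 0)) + (\<Sum>k. W (a (Suc k) / V (u (Suc k))))"
    proof (rule chain_union_bound[where T = T and S = S and \<alpha> = \<alpha> and \<kappa> = \<kappa> and e = \<epsilon>])
      show "norm_VW M V W (\<lambda>\<omega>. X t \<omega> - X (\<alpha> k t) \<omega>) \<le> \<epsilon> k" if "t \<in> S (Suc k)" for k t
        using \<alpha>(2)[OF that] by (simp add: \<rho>)
      show "a (Suc k) = (\<kappa> (card (S (Suc k))))\<^sup>2 * (\<epsilon> k)\<^sup>2" for k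
        by (simp add: assms(16) S_simps F(2))
      show "0 \<le> u k" "0 < u 0" for k
        using \<psi>_nonneg y_pos d by (auto simp: u_def add_nonneg_pos)
      show "a (Suc k) = 0" if "u (Suc k) = 0" for k
        using that y_pos \<psi>_0 by (simp add: u_Suc)
      show "summable u"
        using u_sums by (rule sums_summable)
      show "summable (\<lambda>k. W (a (Suc k) / V (u (Suc k))))"
        using g_summable[OF y] by (simp add: g_def u_Suc)
    qed (fact \<kappa> X S S_simps(1) \<alpha>(1) u_lt)+
    then show ?thesis
      by (simp add: S_simps u_Suc g_def) (simp add: u_def)
  qed

  \<comment> \<open>The left side does not depend on the starting point, so its norm may be replaced by the
    infimum, by continuity of \<open>W\<close> up to \<open>0\<close>; then \<open>d\<close> can be dropped.\<close>
  have bound: "prob ?ES \<le> g 0 y + (\<Sum>k. g (Suc k) y)" if y: "\<Psi> < y" "y < x" for y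
  proof -
    define d where "d = (x - y) / 2"
    have d: "0 < d" "y + d < x"
      using y by (auto simp: d_def field_simps)
    have y_pos: "0 < y"
      using y \<Psi>_nonneg by simp
    let ?w = "\<psi> 0 * y + d"
    have w: "0 < ?w"
      using \<psi>_nonneg y_pos d by (intro add_nonneg_pos) auto
    let ?Q = "(\<lambda>t. (?n t)\<^sup>2) ` T"
    have bdd: "bdd_below ?Q"
      by (intro bdd_belowI2[where m = 0]) simp
    have a_closure: "a 0 \<in> closure ?Q"
      using closure_contains_Inf[OF _ bdd] \<open>T \<noteq> {}\<close> by (simp add: assms(16))
    have clos: "closure ?Q \<subseteq> {0..}"
      by (intro closure_minimal) auto
    have cont: "continuous_on (closure ?Q) (\<lambda>z. W (z / V ?w))"
      using clos V_pos[OF w]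
      by (intro continuous_on_compose2[OF W_continuous_on] continuous_intros) auto
    have "prob ?ES - (\<Sum>k. g (Suc k) y) \<le> W (z / V ?w)" if z: "z \<in> ?Q" for z
    proof -
      obtain t where t: "t \<in> T" "z = (?n t)\<^sup>2"
        using z by blast
      show ?thesis
        using step[OF t(1) y(1) d] unfolding t(2) by linarith
    qed
    then have "prob ?ES - (\<Sum>k. g (Suc k) y) \<le> W (a 0 / V ?w)"
      by (rule continuous_ge_on_closure[OF cont a_closure])
    also have "\<dots> \<le> g 0 y"
    proof (cases "a 0 = 0")
      case False
      then have "\<psi> 0 \<noteq> 0"
        using \<psi>_0[of 0] by blast
      then have "0 < \<psi> 0 * y"
        using \<psi>_nonneg[of 0] y_pos by simp
      then show ?thesis
        unfolding g_def using a_nonneg d by (intro tail_bound_antimono) auto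
    qed (simp add: g_def W_0)
    finally show ?thesis
      by simp
  qed

  \<comment> \<open>The levels dominate the series uniformly in \<open>y\<close>, so \<open>y\<close> may tend to \<open>x\<close> from below.\<close>
  have "x > 0"
    using \<open>x > \<Psi>\<close> \<Psi>_nonneg by simp
  have ev: "\<forall>\<^sub>F y in at_left x. \<Psi> < y \<and> y < x"
    using eventually_at_left_real[OF \<open>x > \<Psi>\<close>] by (auto elim: eventually_mono)
  have g_tendsto: "(g k \<longlongrightarrow> g k x) (at_left x)" for k
  proof -
    have "isCont (g k) x"
      unfolding g_def using a_nonneg \<psi>_nonneg \<psi>_0 \<open>x > 0\<close> by (intro isCont_tail_bound) auto
    then show ?thesis
      by (auto simp: isCont_def intro: tendsto_within_subset)
  qed
  have "((\<lambda>y. \<Sum>k. g (Suc k) y) \<longlongrightarrow> (\<Sum>k. g (Suc k) x)) (at_left x)"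
  proof (rule tannerys_theorem[THEN conjunct2, THEN conjunct2])
    show "\<forall>\<^sub>F (k, y) in at_top \<times>\<^sub>F at_left x. norm (g (Suc k) y) \<le> v (Suc k)"
      unfolding eventually_prod_filter
      using ev g_le g_nonneg \<Psi>_nonneg
      by (intro exI[of _ "\<lambda>_. True"] exI[of _ "\<lambda>y. \<Psi> < y \<and> y < x"]) auto
  qed (use g_tendsto assms(18) in auto)
  then have "((\<lambda>y. g 0 y + (\<Sum>k. g (Suc k) y)) \<longlongrightarrow> g 0 x + (\<Sum>k. g (Suc k) x)) (at_left x)"
    by (intro tendsto_add g_tendsto)
  then have "prob ?ES \<le> g 0 x + (\<Sum>k. g (Suc k) x)"
    using ev bound by (intro tendsto_lowerbound) (auto elim: eventually_mono)
  then show ?thesis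
    using E_le by (simp add: g_def)
qed

end
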